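(* Let $f(k) = \dfrac{4(138k^2 + 52k + 5)}{3(6k + 1)}$. Then the following three series converge and $$\sum_{k=0}^{\infty} \frac{(28k^2 + 10k + 1) \binom{2k}{k}^5}{(6k + 1)(-64)^k \binom{3k}{k} \binom{6k}{3k}} = \frac{3}{\pi},$$ $$\sum_{k=0}^{\infty} \frac{\big((28k^2 + 10k + 1)(2H_{2k} - 3H_k) + 20k + 4\big) \binom{2k}{k}^5}{(6k + 1)(-64)^k \binom{3k}{k} \binom{6k}{3k}} = \frac{18 \log 2}{\pi},$$ $$\sum_{k=0}^{\infty} \frac{\big((28k^2 + 10k + 1)(2H_{6k} - H_{3k} - 3H_k) + f(k)\big) \binom{2k}{k}^5}{(6k + 1)(-64)^k \binom{3k}{k} \binom{6k}{3k}} = \frac{30 \log 2}{\pi}.$$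
   Context: For a nonnegative integer $n$, $H_n=\sum_{0<j\le n}\frac1j$ denotes the $n$-th harmonic number (so $H_0=0$). $\binom{n}{m}$ is the binomial coefficient and $\log$ the natural logarithm. *)

theory Defs
  imports "HOL-Analysis.Analysis"
begin

end

theory Submission
  imports Defs "HOL-Complex_Analysis.Complex_Analysis" "HOL-Real_Asymp.Real_Asymp"
begin

text \<open>
  The three series are the value and two directional derivatives at the origin of one two-parameter series
  $S(x,y)$, obtained as the companion of a WZ pair for Whipple's ${}_3F_2$ sum. A WZ certificate gives
  $S(x,y) = c(x,y)\,S(x+1,y)$; iterating it and letting $x \to \infty$, where only the initial term
  of the series survives, expresses $S$ as
  $4\cdot 4^y\,\Gamma(1+x+y)^2\,\Gamma(\frac52+2x) / (\Gamma(\frac12+2x+2y)\,\Gamma(\frac12+x)^2)$.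
  The direction $(0,1)$ yields the second identity; the direction $(-\frac12,2)$ yields the third one minus
  $\frac83$ times the first. For complex parameters, locally uniform convergence already permits
  differentiation term by term.
\<close>

section \<open>The WZ pair\<close>

text \<open>Normalised so that the term at \<open>n = 0\<close> is 1 for all parameters. At the
  origin it differs from the binomial quotient of the theorem by a factor
  \<open>1 + 2 * of_nat n\<close>, which \<open>wpoly\<close> supplies.\<close>

definition wterm :: "complex \<Rightarrow> complex \<Rightarrow> nat \<Rightarrow> complex" where
  "wterm x y n = (-1) ^ n * (pochhammer (1/2) n)\<^sup>2 * pochhammer (1/2 + 2 * x + 2 * y) n
      * (pochhammer (1/2 + x) n)\<^sup>2 * pochhammer (1/2 - y) n
      / (fact n * (pochhammer (1 + x + y) n)\<^sup>2 * pochhammer (5/2 + 2 * x) (3 * n))"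

text \<open>At \<open>x = y = 0\<close> this factors as (1 + 2m)(28m^2 + 10m + 1). The index is a
  complex argument, so the certificate reduces to polynomial identities.\<close>

definition wpoly :: "complex \<Rightarrow> complex \<Rightarrow> complex \<Rightarrow> complex" where
  "wpoly x y m = 2 * (1 + 2 * x + 4 * m) * (3 + 4 * x + 6 * m) * (x + y + m)
      + (1 + 2 * x + 2 * m) * (1 - 2 * y + 2 * m) * (1 + 2 * m)"

definition wsum :: "complex \<Rightarrow> complex \<Rightarrow> complex" where
  "wsum x y = (\<Sum>n. wterm x y n * wpoly x y (of_nat n))"

lemma wterm_Suc:
  "wterm x y (Suc n) = - wterm x y n
      * (((1/2 + of_nat n)\<^sup>2 * (1/2 + 2 * x + 2 * y + of_nat n) * (1/2 + x + of_nat n)\<^sup>2 * (1/2 - y + of_nat n))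
      / ((1 + of_nat n) * (1 + x + y + of_nat n)\<^sup>2 * (5/2 + 2 * x + 3 * of_nat n)
          * (7/2 + 2 * x + 3 * of_nat n) * (9/2 + 2 * x + 3 * of_nat n)))"
proof -
  have three: "3 * Suc n = Suc (Suc (Suc (3 * n)))"
    by simp
  have "5/2 + 2 * x + of_nat (Suc (3 * n)) = 7/2 + 2 * x + 3 * of_nat n"
    "5/2 + 2 * x + of_nat (Suc (Suc (3 * n))) = 9/2 + 2 * x + 3 * of_nat n"
    by simp_all
  then have *: "pochhammer (5/2 + 2 * x) (3 * Suc n) = pochhammer (5/2 + 2 * x) (3 * n)
      * ((5/2 + 2 * x + 3 * of_nat n) * (7/2 + 2 * x + 3 * of_nat n) * (9/2 + 2 * x + 3 * of_nat n))"
    unfolding three pochhammer_Suc by (simp only: of_nat_mult of_nat_numeral mult.assoc)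
  show ?thesis
    unfolding wterm_def * by (simp add: pochhammer_Suc power_mult_distrib mult_ac)
qed

lemma pochhammer_plus1:
  fixes a :: "'a :: field_char_0"
  assumes "a \<noteq> 0"
  shows "pochhammer (a + 1) n = pochhammer a n * (a + of_nat n) / a"
  using pochhammer_rec[of a n] pochhammer_rec'[of a n] assms by (simp add: field_simps)

lemma Re_pos_nonzero: "0 < Re a \<Longrightarrow> a + of_nat n \<noteq> 0" "0 < Re a \<Longrightarrow> pochhammer a n \<noteq> 0"
proof -
  show *: "a + of_nat n \<noteq> 0" if "0 < Re a" for n
    using that by (auto simp: complex_eq_iff)
  show "pochhammer a n \<noteq> 0" if "0 < Re a"
    using *[OF that] by (auto simp: pochhammer_eq_0_iff eq_neg_iff_add_eq_0)
qed

text \<open>Moving \<open>x\<close> to \<open>x + 1\<close> raises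
  \<open>1/2 + 2 * x + 2 * y\<close> and \<open>5/2 + 2 * x\<close> by two, \<open>1/2 + x\<close>
  and \<open>1 + x + y\<close> by one. Each unit step multiplies a Pochhammer symbol by (a + n)/a;
  the parts free of \<open>n\<close> are gathered on the left, and the hypotheses keep them
  nonzero.\<close>

lemma wterm_shift:
  assumes "Re x > - 1/4" "Re (x + y) > - 1/4"
  shows "(1/2 + 2 * x + 2 * y) * (3/2 + 2 * x + 2 * y) * (1/2 + x)\<^sup>2
      / ((1 + x + y)\<^sup>2 * (5/2 + 2 * x) * (7/2 + 2 * x)) * wterm (x + 1) y n
    = wterm x y n * (((1/2 + 2 * x + 2 * y + of_nat n) * (3/2 + 2 * x + 2 * y + of_nat n) * (1/2 + x + of_nat n)\<^sup>2)
      / ((1 + x + y + of_nat n)\<^sup>2 * (5/2 + 2 * x + 3 * of_nat n) * (7/2 + 2 * x + 3 * of_nat n)))"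
proof -
  define a where "a = 1/2 + 2 * x + 2 * y"
  define b where "b = 1/2 + x"
  define c where "c = 1 + x + y"
  define d where "d = 5/2 + 2 * x"
  have nz: "a \<noteq> 0" "a + 1 \<noteq> 0" "b \<noteq> 0" "c \<noteq> 0" "d \<noteq> 0" "d + 1 \<noteq> 0"
    using assms by (auto simp: a_def b_def c_def d_def complex_eq_iff)
  have eqs: "1/2 + 2 * (x + 1) + 2 * y = a + 1 + 1" "1/2 + (x + 1) = b + 1" "1 + (x + 1) + y = c + 1"
      "5/2 + 2 * (x + 1) = d + 1 + 1" "3/2 + 2 * x + 2 * y = a + 1" "7/2 + 2 * x = d + 1"
    by (simp_all add: a_def b_def c_def d_def)
  have two: "pochhammer (a + 1 + 1) n = pochhammer a n * (a + of_nat n) * (a + 1 + of_nat n) / (a * (a + 1))"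
    if "a \<noteq> 0" "a + 1 \<noteq> 0" for a :: complex and n
    using pochhammer_plus1[OF that(1), of n] pochhammer_plus1[OF that(2), of n] by simp
  show ?thesis
    unfolding wterm_def eqs two[OF nz(1,2)] two[OF nz(5,6)] a_def[symmetric] b_def[symmetric] c_def[symmetric] d_def[symmetric]
    using nz
    by (simp add: pochhammer_plus1 power_mult_distrib power_divide of_nat_mult mult_ac)
qed

text \<open>
  The factor $(\frac12+2x+2y+m)(\frac12+x+m)^2$ common to the shifts in $x$ and in the summation index
  splits the WZ equation for the certificate $16m+4+16x+8y$ into the following two identities.
\<close>

lemma certificate_left:
  fixes x y m :: complex
  shows "wpoly x y m = m * (3/2 + 2 * x + 3 * m) * (16 * m + 4 + 16 * x + 8 * y)
    + 8 * (1/2 + 2 * x + 2 * y + m) * (1/2 + x + m)\<^sup>2"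
  unfolding wpoly_def by (simp add: field_simps power2_eq_square)

lemma certificate_right:
  fixes x y m :: complex
  shows "(3/2 + 2 * x + 2 * y + m) * wpoly (x + 1) y m
    + (1/2 + m)\<^sup>2 * (1/2 - y + m) * (16 * (m + 1) + 4 + 16 * x + 8 * y)
    = 8 * (1 + x + y + m)\<^sup>2 * (5/2 + 2 * x + 3 * m) * (7/2 + 2 * x + 3 * m)"
  unfolding wpoly_def by (simp add: field_simps power2_eq_square)

text \<open>The factor \<open>of_nat n\<close> makes the lower boundary term vanish. At index n + 1,
  the first two factors cancel the denominators \<open>1 + of_nat n\<close> and
  \<open>9/2 + 2 * x + 3 * of_nat n\<close> of the term ratio, which the shift in \<open>x\<close>
  does not share.\<close>

definition wcert :: "complex \<Rightarrow> complex \<Rightarrow> nat \<Rightarrow> complex" where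
  "wcert x y n = wterm x y n * (of_nat n * (3/2 + 2 * x + 3 * of_nat n) * (16 * of_nat n + 4 + 16 * x + 8 * y))"

text \<open>The factor c(x,y) of the recurrence. It is the quotient of the Gamma products of the
  closed form at (x,y) and at (x+1,y).\<close>

definition wratio :: "complex \<Rightarrow> complex \<Rightarrow> complex" where
  "wratio x y = (1/2 + 2 * x + 2 * y) * (3/2 + 2 * x + 2 * y) * (1/2 + x)\<^sup>2
      / ((1 + x + y)\<^sup>2 * (5/2 + 2 * x) * (7/2 + 2 * x))"

text \<open>Every term is \<open>wterm x y n\<close> times a rational function of \<open>m\<close>.
  With B the value contributed by the certificate at n + 1, both sides become
  \<open>wterm x y n\<close> times 8L - B - \<open>wpoly x y m\<close>.\<close>

lemma wz_equation:
  assumes "Re x > - 1/4" "Re (x + y) > - 1/4"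
  shows "wratio x y * (wterm (x + 1) y n * wpoly (x + 1) y (of_nat n)) - wterm x y n * wpoly x y (of_nat n)
    = wcert x y (Suc n) - wcert x y n"
proof -
  define m :: complex where "m = of_nat n"
  define L where "L = (1/2 + 2 * x + 2 * y + m) * (1/2 + x + m)\<^sup>2"
  define D where "D = (1 + x + y + m)\<^sup>2 * (5/2 + 2 * x + 3 * m) * (7/2 + 2 * x + 3 * m)"
  define s where "s = (\<lambda>m::complex. 16 * m + 4 + 16 * x + 8 * y)"
  have nz: "D \<noteq> 0" "1 + m \<noteq> 0" "9/2 + 2 * x + 3 * m \<noteq> 0"
  proof -
    have "1 + x + y + m \<noteq> 0" "5/2 + 2 * x + 3 * m \<noteq> 0" "7/2 + 2 * x + 3 * m \<noteq> 0"
      using assms unfolding m_def by (auto simp: complex_eq_iff)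
    then show "D \<noteq> 0"
      by (simp add: D_def)
    show "1 + m \<noteq> 0" "9/2 + 2 * x + 3 * m \<noteq> 0"
      using assms unfolding m_def by (auto simp: complex_eq_iff)
  qed
  have "wratio x y * wterm (x + 1) y n = wterm x y n * ((3/2 + 2 * x + 2 * y + m) * L / D)"
    using wterm_shift[OF assms, of n] unfolding wratio_def m_def L_def D_def by (simp add: mult_ac)
  then have 1: "wratio x y * (wterm (x + 1) y n * wpoly (x + 1) y m)
      = wterm x y n * ((3/2 + 2 * x + 2 * y + m) * L / D * wpoly (x + 1) y m)"
    by (metis mult.assoc)
  have "wterm x y (Suc n) = - wterm x y n * ((1/2 + m)\<^sup>2 * (1/2 - y + m) * L / D / ((1 + m) * (9/2 + 2 * x + 3 * m)))"
    unfolding wterm_Suc[of x y n] m_def[symmetric] L_def D_def by (simp add: mult_ac)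
  moreover have "of_nat (Suc n) = 1 + m" "3/2 + 2 * x + 3 * (1 + m) = 9/2 + 2 * x + 3 * m"
    by (simp_all add: m_def)
  ultimately have 2: "wcert x y (Suc n) = - wterm x y n * ((1/2 + m)\<^sup>2 * (1/2 - y + m) * L / D * s (m + 1))"
    unfolding wcert_def s_def using nz(2,3) by (simp add: add_ac)
  have 3: "wcert x y n = wterm x y n * (wpoly x y m - 8 * L)"
    unfolding wcert_def certificate_left m_def[symmetric] L_def by simp
  have "(3/2 + 2 * x + 2 * y + m) * wpoly (x + 1) y m + (1/2 + m)\<^sup>2 * (1/2 - y + m) * s (m + 1) = 8 * D"
    using certificate_right[of x y m] by (simp add: D_def s_def mult_ac)
  \<comment> \<open>Multiplying \<open>certificate_right\<close> by \<open>L / D\<close> replaces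
    the right-hand \<open>8 * D\<close> by \<open>8 * L\<close>, the same quantity that
    \<open>certificate_left\<close> leaves over.\<close>
  moreover have "A * L / D * p = 8 * L - B * L / D * q" if "A * p + B * q = 8 * D" for A B p q
  proof -
    have "A * L / D * p + B * L / D * q = (A * p + B * q) * L / D"
      by (simp add: add_divide_distrib distrib_left mult_ac)
    then show ?thesis
      unfolding that using nz(1) by (simp add: eq_diff_eq)
  qed
  ultimately have 4: "(3/2 + 2 * x + 2 * y + m) * L / D * wpoly (x + 1) y m
      = 8 * L - (1/2 + m)\<^sup>2 * (1/2 - y + m) * L / D * s (m + 1)"
    by blast
  then show ?thesis
    unfolding 2 3 m_def[symmetric] 1 4 by (simp only: right_diff_distrib mult_minus_left) simp
qed

section \<open>Estimates uniform in the shift\<close>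

text \<open>Four numerator factors are dominated by four denominator factors, uniformly in
  \<open>N\<close>; what remains is (1/2 + n)^2 over the last two factors. The eighths come from
  moving real parts by at most 2/16.\<close>

lemma norm_wterm_ratio:
  assumes u: "norm u \<le> 1/16" and y: "norm y \<le> 1/16" and x: "x = u + of_nat N"
  shows "norm (wterm x y (Suc n)) \<le> norm (wterm x y n)
    * ((real n + 1/2)\<^sup>2 / ((2 * real N + 3 * real n + 27/8) * (2 * real N + 3 * real n + 35/8)))"
proof -
  have up: "norm (z + of_nat k) \<le> r + real k" if "norm z \<le> r" for z :: complex and k :: nat and r :: real
    using norm_triangle_ineq[of z "of_nat k"] that by simp
  have re: "Re u \<ge> - 1/16" "Re y \<ge> - 1/16"
    using abs_Re_le_cmod[of u] abs_Re_le_cmod[of y] u y by linarith+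
  have "norm (1/2 + 2 * u + 2 * y) \<le> norm (1/2 :: complex) + norm (2 * u) + norm (2 * y)"
    by (meson norm_triangle_mono order_refl norm_triangle_ineq)
  then have "norm (1/2 + 2 * u + 2 * y) \<le> 3/4"
    using u y by (simp add: norm_mult norm_divide)
  from up[OF this, of "2 * N + n"] have n1: "norm (1/2 + 2 * x + 2 * y + of_nat n) \<le> 2 * real N + real n + 3/4"
    by (simp add: x algebra_simps)
  have "norm (1/2 + u) \<le> 9/16"
    using norm_triangle_ineq[of "1/2" u] u by (simp add: norm_divide)
  from up[OF this, of "N + n"] have n2: "norm (1/2 + x + of_nat n) \<le> real N + real n + 9/16"
    by (simp add: x algebra_simps)
  have "norm (1/2 - y) \<le> 9/16"
    using norm_triangle_ineq4[of "1/2" y] y by (simp add: norm_divide)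
  from up[OF this, of n] have n3: "norm (1/2 - y + of_nat n) \<le> real n + 9/16"
    by simp
  have n4: "norm (1/2 + of_nat n :: complex) \<le> real n + 1/2"
    using up[of "1/2" "1/2" n] by (simp add: norm_divide)
  have d1: "norm (1 + of_nat n :: complex) \<ge> 1 + real n"
    using complex_Re_le_cmod[of "1 + of_nat n"] by simp
  have d2: "norm (1 + x + y + of_nat n) \<ge> real N + real n + 7/8"
    using complex_Re_le_cmod[of "1 + x + y + of_nat n"] re by (simp add: x)
  have d3: "norm (5/2 + 2 * x + 3 * of_nat n) \<ge> 2 * real N + 3 * real n + 19/8"
    using complex_Re_le_cmod[of "5/2 + 2 * x + 3 * of_nat n"] re by (simp add: x)
  have d4: "norm (7/2 + 2 * x + 3 * of_nat n) \<ge> 2 * real N + 3 * real n + 27/8"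
    using complex_Re_le_cmod[of "7/2 + 2 * x + 3 * of_nat n"] re by (simp add: x)
  have d5: "norm (9/2 + 2 * x + 3 * of_nat n) \<ge> 2 * real N + 3 * real n + 35/8"
    using complex_Re_le_cmod[of "9/2 + 2 * x + 3 * of_nat n"] re by (simp add: x)
  \<comment> \<open>The lower bounds of the denominators that absorb numerator factors;
    \<open>W\<close> then cancels from the quotient.\<close>
  define W where "W = (1 + real n) * (real N + real n + 7/8)\<^sup>2 * (2 * real N + 3 * real n + 19/8)"
  have W: "W > 0"
    unfolding W_def by (intro mult_pos_pos zero_less_power) linarith+
  have "norm ((1/2 + of_nat n)\<^sup>2 * (1/2 + 2 * x + 2 * y + of_nat n) * (1/2 + x + of_nat n)\<^sup>2 * (1/2 - y + of_nat n))
      \<le> (real n + 1/2)\<^sup>2 * (2 * real N + 3 * real n + 19/8) * (real N + real n + 7/8)\<^sup>2 * (1 + real n)"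
    unfolding norm_mult norm_power
    using n1 n2 n3 n4 by (intro mult_mono power_mono) auto
  moreover have "W * ((2 * real N + 3 * real n + 27/8) * (2 * real N + 3 * real n + 35/8))
      \<le> norm ((1 + of_nat n) * (1 + x + y + of_nat n)\<^sup>2 * (5/2 + 2 * x + 3 * of_nat n)
          * (7/2 + 2 * x + 3 * of_nat n) * (9/2 + 2 * x + 3 * of_nat n))"
    unfolding norm_mult norm_power W_def mult.assoc[symmetric]
    by (intro mult_mono power_mono d1 d2 d3 d4 d5) auto
  ultimately have "norm (((1/2 + of_nat n)\<^sup>2 * (1/2 + 2 * x + 2 * y + of_nat n) * (1/2 + x + of_nat n)\<^sup>2 * (1/2 - y + of_nat n))
      / ((1 + of_nat n) * (1 + x + y + of_nat n)\<^sup>2 * (5/2 + 2 * x + 3 * of_nat n)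
          * (7/2 + 2 * x + 3 * of_nat n) * (9/2 + 2 * x + 3 * of_nat n)))
    \<le> (W * (real n + 1/2)\<^sup>2) / (W * ((2 * real N + 3 * real n + 27/8) * (2 * real N + 3 * real n + 35/8)))"
    unfolding norm_divide using W by (intro frac_le) (auto simp: W_def mult_ac)
  then have "norm (((1/2 + of_nat n)\<^sup>2 * (1/2 + 2 * x + 2 * y + of_nat n) * (1/2 + x + of_nat n)\<^sup>2 * (1/2 - y + of_nat n))
      / ((1 + of_nat n) * (1 + x + y + of_nat n)\<^sup>2 * (5/2 + 2 * x + 3 * of_nat n)
          * (7/2 + 2 * x + 3 * of_nat n) * (9/2 + 2 * x + 3 * of_nat n)))
    \<le> (real n + 1/2)\<^sup>2 / ((2 * real N + 3 * real n + 27/8) * (2 * real N + 3 * real n + 35/8))"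
    using W by simp
  then show ?thesis
    unfolding wterm_Suc norm_mult[of "- wterm x y n"] norm_minus_cancel
    by (rule mult_left_mono) simp
qed

text \<open>The ratio is at most 1/9 because 3n + 3/2 lies below both remaining factors. The first
  step, from index 0 to 1, gains another factor 1/(N+1)^2, which later makes all terms but the
  initial one negligible.\<close>

lemma norm_wterm_le:
  assumes u: "norm u \<le> 1/16" and y: "norm y \<le> 1/16" and x: "x = u + of_nat N"
  shows "norm (wterm x y n) \<le> (1/9) ^ n" "norm (wterm x y (Suc n)) \<le> (1/9) ^ n / (real N + 1)\<^sup>2"
proof -
  have r: "(real n + 1/2)\<^sup>2 / ((2 * real N + 3 * real n + 27/8) * (2 * real N + 3 * real n + 35/8)) \<le> 1/9" for n
  proof -
    have "9 * (real n + 1/2)\<^sup>2 = (3 * real n + 3/2) * (3 * real n + 3/2)"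
      by (simp add: power2_eq_square algebra_simps)
    also have "\<dots> \<le> (2 * real N + 3 * real n + 27/8) * (2 * real N + 3 * real n + 35/8)"
      by (intro mult_mono) auto
    finally show ?thesis
      by (simp add: divide_le_eq add_nonneg_pos mult_pos_pos add.assoc)
  qed
  have step: "norm (wterm x y (Suc n)) \<le> norm (wterm x y n) * (1/9)" for n
    using norm_wterm_ratio[OF assms, of n] mult_left_mono[OF r[of n], of "norm (wterm x y n)"]
    by (rule order_trans) simp
  show "norm (wterm x y n) \<le> (1/9) ^ n"
  proof (induction n)
    case 0
    show ?case by (simp add: wterm_def)
  next
    case (Suc n)
    then show ?case using step[of n] by simp
  qed
  show "norm (wterm x y (Suc n)) \<le> (1/9) ^ n / (real N + 1)\<^sup>2"
  proof (induction n)
    case 0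
    have "norm (wterm x y (Suc 0)) \<le> (1/2)\<^sup>2 / ((2 * real N + 27/8) * (2 * real N + 35/8))"
      using norm_wterm_ratio[OF assms, of 0] by (simp add: wterm_def)
    also have "\<dots> \<le> 1 / (real N + 1)\<^sup>2"
      unfolding power2_eq_square by (intro frac_le mult_mono) auto
    finally show ?case by simp
  next
    case (Suc n)
    then show ?case using step[of "Suc n"] by simp
  qed
qed

text \<open>Lets the cubic growth of the polynomial factors be absorbed: (1/9)^n times a cube is at
  most (8/9)^n.\<close>

lemma cube_le_power8: "(real n + 1) ^ 3 \<le> 8 ^ n"
proof (induction n)
  case (Suc n)
  have "(real (Suc n) + 1) ^ 3 \<le> (2 * (real n + 1)) ^ 3"
    by (intro power_mono) auto
  also have "\<dots> = 8 * (real n + 1) ^ 3"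
    by (subst power_mult_distrib) simp
  finally show ?case using Suc by simp
qed simp

lemma norm_wpoly_le:
  assumes u: "norm u \<le> 1/16" and y: "norm y \<le> 1/16" and x: "x = u + of_nat N"
  shows "norm (wpoly x y (of_nat n)) \<le> 68 * (real N + 1) ^ 3 * (real n + 1) ^ 3"
proof -
  \<comment> \<open>A common bound for all linear factors that separates the growth in
    \<open>N\<close> from that in \<open>n\<close>.\<close>
  define M where "M = (real N + 1) * (real n + 1)"
  \<comment> \<open>Naming the product \<open>real N * real n\<close> makes the following
    comparisons linear.\<close>
  obtain q where "q = real N * real n" "q \<ge> 0"
    by simp
  then have M: "M = q + real N + real n + 1" "q \<ge> 0"
    by (simp_all add: M_def algebra_simps)
  have x_le: "norm x \<le> real N + 1/16"
    using norm_triangle_ineq[of u "of_nat N"] u by (simp add: x)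
  have tri: "norm (a + b * v + c * of_nat n) \<le> norm a + norm b * norm v + norm c * real n" for a b c v :: complex
    by (intro norm_triangle_mono) (simp_all add: norm_mult)
  have 1: "norm (1 + 2 * x + 4 * of_nat n) \<le> 5 * M"
    using tri[of 1 2 x 4] x_le M by simp
  have 2: "norm (3 + 4 * x + 6 * of_nat n) \<le> 6 * M"
    using tri[of 3 4 x 6] x_le M by simp
  have 3: "norm (x + y + of_nat n) \<le> M"
    using tri[of x 1 y 1] x_le y M by simp
  have 4: "norm (1 + 2 * x + 2 * of_nat n) \<le> 2 * M"
    using tri[of 1 2 x 2] x_le M by simp
  have 5: "norm (1 - 2 * y + 2 * of_nat n) \<le> 2 * M"
    using tri[of 1 "-2" y 2] y M by simp
  have 6: "norm (1 + 2 * of_nat n :: complex) \<le> 2 * M"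
    using tri[of 1 0 0 2] M by simp
  have "norm (wpoly x y (of_nat n)) \<le> norm (2 * (1 + 2 * x + 4 * of_nat n) * (3 + 4 * x + 6 * of_nat n) * (x + y + of_nat n))
      + norm ((1 + 2 * x + 2 * of_nat n) * (1 - 2 * y + 2 * of_nat n) * (1 + 2 * of_nat n))"
    unfolding wpoly_def by (rule norm_triangle_ineq)
  \<comment> \<open>The constant 68 is 2*5*6 + 2*2*2.\<close>
  also have "\<dots> \<le> 2 * (5 * M) * (6 * M) * M + (2 * M) * (2 * M) * (2 * M)"
    unfolding norm_mult using 1 2 3 4 5 6 M by (intro add_mono mult_mono) auto
  also have "\<dots> = 68 * M ^ 3"
    by (simp add: power3_eq_cube)
  finally show ?thesis
    by (simp add: M_def power_mult_distrib mult.assoc)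
qed

text \<open>The first bound serves convergence and, at \<open>N = 0\<close>, differentiation. In the
  second, (N+1)^3 from the polynomial meets 1/(N+1)^2 from the terms, so the tail grows only
  linearly in \<open>N\<close>.\<close>

lemma norm_wsummand_le:
  assumes u: "norm u \<le> 1/16" and y: "norm y \<le> 1/16" and x: "x = u + of_nat N"
  shows "norm (wterm x y n * wpoly x y (of_nat n)) \<le> 68 * (real N + 1) ^ 3 * (8/9) ^ n"
    "norm (wterm x y (Suc n) * wpoly x y (of_nat (Suc n))) \<le> 68 * 8 * (real N + 1) * (8/9) ^ n"
proof -
  have "norm (wterm x y n * wpoly x y (of_nat n)) \<le> (1/9) ^ n * (68 * (real N + 1) ^ 3 * 8 ^ n)"
    unfolding norm_mult
    by (intro mult_mono norm_wterm_le(1)[OF assms] order_trans[OF norm_wpoly_le[OF assms]]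
        mult_left_mono cube_le_power8) auto
  also have "\<dots> = 68 * (real N + 1) ^ 3 * (8/9) ^ n"
    by (simp add: power_divide)
  finally show "norm (wterm x y n * wpoly x y (of_nat n)) \<le> 68 * (real N + 1) ^ 3 * (8/9) ^ n" .
  have "norm (wterm x y (Suc n) * wpoly x y (of_nat (Suc n)))
      \<le> (1/9) ^ n / (real N + 1)\<^sup>2 * (68 * (real N + 1) ^ 3 * 8 ^ Suc n)"
    unfolding norm_mult
    by (intro mult_mono norm_wterm_le(2)[OF assms] order_trans[OF norm_wpoly_le[OF assms]]
        mult_left_mono cube_le_power8) auto
  also have "\<dots> = 68 * 8 * (real N + 1) * (8/9) ^ n"
    by (simp add: power_divide power2_eq_square power3_eq_cube)
  finally show "norm (wterm x y (Suc n) * wpoly x y (of_nat (Suc n))) \<le> 68 * 8 * (real N + 1) * (8/9) ^ n" .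
qed

section \<open>Convergence and vanishing boundary terms\<close>

lemma wsum_sums:
  assumes u: "norm u \<le> 1/16" and y: "norm y \<le> 1/16" and x: "x = u + of_nat N"
  shows "(\<lambda>n. wterm x y n * wpoly x y (of_nat n)) sums wsum x y"
  unfolding wsum_def
proof (rule summable_sums, rule summable_comparison_test')
  show "summable (\<lambda>n. 68 * (real N + 1) ^ 3 * (8/9) ^ n)"
    by (intro summable_mult summable_geometric) simp
  show "norm (wterm x y n * wpoly x y (of_nat n)) \<le> 68 * (real N + 1) ^ 3 * (8/9) ^ n" if "n \<ge> 0" for n
    by (rule norm_wsummand_le(1)[OF assms])
qed

lemma wcert_tendsto_0:
  assumes u: "norm u \<le> 1/16" and y: "norm y \<le> 1/16" and x: "x = u + of_nat N"
  shows "wcert x y \<longlonglongrightarrow> 0"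
proof (rule Lim_null_comparison)
  define C where "C = (5 + 2 * norm x) * (20 + 16 * norm x + 8 * norm y)"
  have C: "C \<ge> 0"
    by (simp add: C_def)
  show "(\<lambda>n. C * (8/9) ^ n) \<longlonglongrightarrow> 0"
    by (intro tendsto_mult_right_zero LIMSEQ_power_zero) simp
  show "\<forall>\<^sub>F n in sequentially. norm (wcert x y n) \<le> C * (8/9) ^ n"
  proof (intro always_eventually allI)
    fix n
    have "norm (3/2 + 2 * x + 3 * of_nat n) \<le> 3/2 + 2 * norm x + 3 * real n"
      by (intro norm_triangle_mono) (simp_all add: norm_mult norm_divide)
    also have "\<dots> \<le> (5 + 2 * norm x) * (real n + 1)"
      by (simp add: algebra_simps)
    finally have 1: "norm (3/2 + 2 * x + 3 * of_nat n) \<le> (5 + 2 * norm x) * (real n + 1)" .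
    have "norm (16 * of_nat n + 4 + 16 * x + 8 * y) \<le> 16 * real n + 4 + 16 * norm x + 8 * norm y"
      by (intro norm_triangle_mono) (simp_all add: norm_mult norm_divide)
    also have "\<dots> \<le> (20 + 16 * norm x + 8 * norm y) * (real n + 1)"
      by (simp add: algebra_simps)
    finally have 2: "norm (16 * of_nat n + 4 + 16 * x + 8 * y) \<le> (20 + 16 * norm x + 8 * norm y) * (real n + 1)" .
    have "norm (wcert x y n) \<le> (1/9) ^ n * ((real n + 1) * ((5 + 2 * norm x) * (real n + 1))
        * ((20 + 16 * norm x + 8 * norm y) * (real n + 1)))"
      unfolding wcert_def norm_mult
      by (intro mult_mono norm_wterm_le(1)[OF assms] 1 2) auto
    also have "\<dots> = (1/9) ^ n * (C * (real n + 1) ^ 3)"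
      by (simp add: C_def power3_eq_cube)
    also have "\<dots> \<le> (1/9) ^ n * (C * 8 ^ n)"
      using cube_le_power8[of n] C by (intro mult_left_mono) auto
    also have "\<dots> = C * (8/9) ^ n"
      by (simp add: power_divide)
    finally show "norm (wcert x y n) \<le> C * (8/9) ^ n" .
  qed
qed

section \<open>Evaluation of the parametric series\<close>

text \<open>Summing the WZ equation over \<open>n\<close> telescopes. The certificate tends to 0 at
  infinity and vanishes at \<open>n = 0\<close>, so nothing is left on the right.\<close>

lemma wsum_rec:
  assumes u: "norm u \<le> 1/16" and y: "norm y \<le> 1/16" and x: "x = u + of_nat N"
  shows "wsum x y = wratio x y * wsum (x + 1) y"
proof -
  have re: "Re u \<ge> - 1/16" "Re y \<ge> - 1/16"
    using abs_Re_le_cmod[of u] abs_Re_le_cmod[of y] u y by linarith+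
  have x1: "x + 1 = u + of_nat (Suc N)"
    by (simp add: x)
  have "(\<lambda>n. wcert x y (Suc n) - wcert x y n) sums (wratio x y * wsum (x + 1) y - wsum x y)"
    using sums_diff[OF sums_mult[OF wsum_sums[OF u y x1], of "wratio x y"] wsum_sums[OF assms]]
    by (subst (asm) wz_equation) (use re in \<open>auto simp: x\<close>)
  moreover have "(\<lambda>n. wcert x y (Suc n) - wcert x y n) sums (0 - wcert x y 0)"
    by (rule telescope_sums[OF wcert_tendsto_0[OF assms]])
  ultimately have "wratio x y * wsum (x + 1) y - wsum x y = - wcert x y 0"
    using sums_unique2 by fastforce
  then show ?thesis
    by (simp add: wcert_def)
qed

lemma wsum_iterate:
  assumes u: "norm u \<le> 1/16" and y: "norm y \<le> 1/16"
  shows "wsum u y = pochhammer (1/2 + 2 * u + 2 * y) (2 * N) * (pochhammer (1/2 + u) N)\<^sup>2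
      / ((pochhammer (1 + u + y) N)\<^sup>2 * pochhammer (5/2 + 2 * u) (2 * N)) * wsum (u + of_nat N) y"
proof (induction N)
  case (Suc N)
  have two: "pochhammer a (2 * Suc N) = pochhammer a (2 * N) * ((a + 2 * of_nat N) * (a + 1 + 2 * of_nat N))"
    for a :: complex
    by (simp add: pochhammer_Suc add_ac mult_ac)
  define m :: complex where "m = of_nat N"
  have eqs: "1/2 + 2 * (u + m) + 2 * y = 1/2 + 2 * u + 2 * y + 2 * m"
      "3/2 + 2 * (u + m) + 2 * y = 1/2 + 2 * u + 2 * y + 1 + 2 * m" "1/2 + (u + m) = 1/2 + u + m"
      "1 + (u + m) + y = 1 + u + y + m" "5/2 + 2 * (u + m) = 5/2 + 2 * u + 2 * m"
      "7/2 + 2 * (u + m) = 5/2 + 2 * u + 1 + 2 * m"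
    by simp_all
  have "wsum (u + of_nat N) y = wratio (u + of_nat N) y * wsum (u + of_nat N + 1) y"
    by (rule wsum_rec[OF u y refl])
  moreover have "u + of_nat N + 1 = u + of_nat (Suc N)"
    by simp
  ultimately show ?case
    unfolding Suc.IH two pochhammer_Suc wratio_def m_def[symmetric] eqs
    by (simp add: power_mult_distrib mult_ac)
qed simp

text \<open>The term at \<open>n = 0\<close> is \<open>wpoly (u + of_nat N) y 0\<close>, with
  leading part 2*2*4*N^3, while the tail is O(N).\<close>

lemma wsum_asymp:
  assumes u: "norm u \<le> 1/16" and y: "norm y \<le> 1/16"
  shows "(\<lambda>N. wsum (u + of_nat N) y / of_nat N ^ 3) \<longlonglongrightarrow> 16"
proof -
  let ?P = "\<lambda>N. wpoly (u + of_nat N) y 0"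
  \<comment> \<open>4896 = 68 * 8 * 9, where 9 is the sum of the geometric series of ratio
    8/9.\<close>
  have "norm (wsum (u + of_nat N) y - ?P N) \<le> 4896 * (real N + 1)" for N
  proof -
    let ?x = "u + of_nat N"
    have "(\<lambda>n. wterm ?x y (Suc n) * wpoly ?x y (of_nat (Suc n))) sums (wsum ?x y - ?P N)"
      using wsum_sums[OF u y refl, of N] by (subst sums_Suc_iff) (simp add: wterm_def)
    moreover have g: "(\<lambda>n. 68 * 8 * (real N + 1) * (8/9) ^ n) sums (68 * 8 * (real N + 1) * (1 / (1 - 8/9)))"
      by (intro sums_mult geometric_sums) simp
    ultimately have "norm (wsum ?x y - ?P N) \<le> 68 * 8 * (real N + 1) * (1 / (1 - 8/9))"
      using norm_suminf_le[of "\<lambda>n. wterm ?x y (Suc n) * wpoly ?x y (of_nat (Suc n))"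
          "\<lambda>n. 68 * 8 * (real N + 1) * (8/9) ^ n"] norm_wsummand_le(2)[OF u y refl, of N]
      by (simp add: sums_iff)
    then show ?thesis by simp
  qed
  then have "norm ((wsum (u + of_nat N) y - ?P N) / of_nat N ^ 3) \<le> 4896 * (real N + 1) / real N ^ 3" for N
    by (simp add: norm_divide norm_power divide_right_mono)
  then have 1: "(\<lambda>N. (wsum (u + of_nat N) y - ?P N) / of_nat N ^ 3) \<longlonglongrightarrow> 0"
    by (rule Lim_null_comparison[OF always_eventually[OF allI]]) real_asymp
  \<comment> \<open>Each linear factor of the initial term divided by N; in the second product one
    factor keeps a nonzero limit and two tend to 0.\<close>
  have "(\<lambda>N. 2 * ((1 + 2 * u) / of_nat N + 2) * ((3 + 4 * u) / of_nat N + 4) * ((u + y) / of_nat N + 1)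
      + ((1 + 2 * u) / of_nat N + 2) * ((1 - 2 * y) / of_nat N) * (1 / of_nat N))
      \<longlonglongrightarrow> 2 * (0 + 2) * (0 + 4) * (0 + 1) + (0 + 2) * 0 * 0"
    by (intro tendsto_intros lim_const_over_n)
  also have "?this \<longleftrightarrow> (\<lambda>N. ?P N / of_nat N ^ 3) \<longlonglongrightarrow> 2 * (0 + 2) * (0 + 4) * (0 + 1) + (0 + 2) * 0 * 0"
    by (rule tendsto_cong, rule eventually_mono[OF eventually_gt_at_top[of 0]])
      (simp add: wpoly_def field_simps power3_eq_cube)
  finally have "(\<lambda>N. (wsum (u + of_nat N) y - ?P N) / of_nat N ^ 3 + ?P N / of_nat N ^ 3) \<longlonglongrightarrow> 0 + 16"
    by (intro tendsto_add 1) simp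
  then show ?thesis
    by (simp add: diff_divide_distrib)
qed

section \<open>Gamma limits of Pochhammer quotients\<close>

lemma Gamma_Re_pos_nonzero: "0 < Re a \<Longrightarrow> Gamma a \<noteq> 0"
  by (auto simp: Gamma_eq_zero_iff elim!: nonpos_Ints_cases')

text \<open>Euler's limit in the form \<open>Gamma_series'\<close> is applied at N for
  \<open>b\<close>, \<open>c\<close> and at 2N for \<open>a\<close>, \<open>d\<close>. The
  factorials cancel, and the powers combine to 2^(d-a) N^(2c+d-a-2b) = 2^(2-2y) N^3, which explains
  the cube and the exponential prefactor.\<close>

lemma pochhammer_quotient_asymp:
  fixes u y :: complex
  assumes u: "norm u \<le> 1/16" and y: "norm y \<le> 1/16"
  shows "(\<lambda>N. pochhammer (1/2 + 2 * u + 2 * y) (2 * N) * (pochhammer (1/2 + u) N)\<^sup>2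
      / ((pochhammer (1 + u + y) N)\<^sup>2 * pochhammer (5/2 + 2 * u) (2 * N)) * of_nat N ^ 3)
    \<longlonglongrightarrow> exp (2 * (y - 1) * of_real (ln 2)) * ((Gamma (1 + u + y))\<^sup>2 * Gamma (5/2 + 2 * u)
      / (Gamma (1/2 + 2 * u + 2 * y) * (Gamma (1/2 + u))\<^sup>2))"
proof -
  define a where "a = 1/2 + 2 * u + 2 * y"
  define b where "b = 1/2 + u"
  define c where "c = 1 + u + y"
  define d where "d = 5/2 + 2 * u"
  have re: "Re u \<ge> - 1/16" "Re y \<ge> - 1/16"
    using abs_Re_le_cmod[of u] abs_Re_le_cmod[of y] u y by linarith+
  then have pos: "0 < Re a" "0 < Re b" "0 < Re c" "0 < Re d"
    by (auto simp: a_def b_def c_def d_def)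
  have two: "strict_mono (\<lambda>N::nat. 2 * N)"
    by (simp add: strict_mono_def)
  have double: "(\<lambda>N. Gamma_series' z (2 * N)) \<longlonglongrightarrow> Gamma z" for z :: complex
    using LIMSEQ_subseq_LIMSEQ[OF Gamma_series'_LIMSEQ two, of z] by (simp add: o_def)
  have lim: "(\<lambda>N. exp (2 * (y - 1) * of_real (ln 2)) * ((Gamma_series' c N)\<^sup>2 * Gamma_series' d (2 * N)
      / (Gamma_series' a (2 * N) * (Gamma_series' b N)\<^sup>2)))
    \<longlonglongrightarrow> exp (2 * (y - 1) * of_real (ln 2)) * ((Gamma c)\<^sup>2 * Gamma d / (Gamma a * (Gamma b)\<^sup>2))"
    using pos by (intro tendsto_intros Gamma_series'_LIMSEQ double) (simp add: Gamma_Re_pos_nonzero)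
  have "pochhammer a (2 * N) * (pochhammer b N)\<^sup>2 / ((pochhammer c N)\<^sup>2 * pochhammer d (2 * N)) * of_nat N ^ 3
      = exp (2 * (y - 1) * of_real (ln 2)) * ((Gamma_series' c N)\<^sup>2 * Gamma_series' d (2 * N)
      / (Gamma_series' a (2 * N) * (Gamma_series' b N)\<^sup>2))" if "N > 0" for N
  proof -
    define l :: complex where "l = of_real (ln (real N))"
    define l2 :: complex where "l2 = of_real (ln 2)"
    have ln: "complex_of_real (ln (real (2 * N))) = l2 + l"
      using that by (simp add: l_def l2_def ln_mult)
    have "exp l = of_nat N"
      using that unfolding l_def exp_of_real by simp
    then have N3: "of_nat N ^ 3 = exp l * exp l * exp l"
      by (simp add: power3_eq_cube)
    have e: "exp (2 * (y - 1) * l2) * (exp (c * l))\<^sup>2 * exp (d * (l2 + l))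
        = of_nat N ^ 3 * exp (a * (l2 + l)) * (exp (b * l))\<^sup>2"
      unfolding N3 power2_eq_square exp_add[symmetric] a_def b_def c_def d_def
      by (rule arg_cong[where f = exp]) (simp add: algebra_simps)
    have "exp (2 * (y - 1) * l2) * ((Gamma_series' c N)\<^sup>2 * Gamma_series' d (2 * N)
        / (Gamma_series' a (2 * N) * (Gamma_series' b N)\<^sup>2))
      = pochhammer a (2 * N) * (pochhammer b N)\<^sup>2 / ((pochhammer c N)\<^sup>2 * pochhammer d (2 * N))
        * ((exp (2 * (y - 1) * l2) * (exp (c * l))\<^sup>2 * exp (d * (l2 + l))) / (exp (a * (l2 + l)) * (exp (b * l))\<^sup>2))"
      unfolding Gamma_series'_def ln l_def[symmetric]
      by (simp add: power_mult_distrib power_divide mult_ac)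
    also have "\<dots> = pochhammer a (2 * N) * (pochhammer b N)\<^sup>2 / ((pochhammer c N)\<^sup>2 * pochhammer d (2 * N)) * of_nat N ^ 3"
      unfolding e by simp
    finally show ?thesis
      unfolding l2_def by simp
  qed
  then have "\<forall>\<^sub>F N in sequentially. exp (2 * (y - 1) * of_real (ln 2)) * ((Gamma_series' c N)\<^sup>2 * Gamma_series' d (2 * N)
      / (Gamma_series' a (2 * N) * (Gamma_series' b N)\<^sup>2))
    = pochhammer a (2 * N) * (pochhammer b N)\<^sup>2 / ((pochhammer c N)\<^sup>2 * pochhammer d (2 * N)) * of_nat N ^ 3"
    by (intro eventually_mono[OF eventually_gt_at_top[of 0]]) simp
  from Lim_transform_eventually[OF lim this] show ?thesis
    by (simp only: a_def b_def c_def d_def)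
qed

text \<open>By \<open>wsum_iterate\<close> the product of the two sequences equals
  \<open>wsum u y\<close> for every positive N, so its limit is that value. The constants combine as
  16 * 4^(y-1) = 4 * 4^y.\<close>

lemma wsum_closed:
  assumes u: "norm u \<le> 1/16" and y: "norm y \<le> 1/16"
  shows "wsum u y = 4 * exp (2 * of_real (ln 2) * y) * (Gamma (1 + u + y))\<^sup>2 * Gamma (5/2 + 2 * u)
      / (Gamma (1/2 + 2 * u + 2 * y) * (Gamma (1/2 + u))\<^sup>2)"
proof -
  let ?C = "\<lambda>N. pochhammer (1/2 + 2 * u + 2 * y) (2 * N) * (pochhammer (1/2 + u) N)\<^sup>2
      / ((pochhammer (1 + u + y) N)\<^sup>2 * pochhammer (5/2 + 2 * u) (2 * N))"
  let ?G = "(Gamma (1 + u + y))\<^sup>2 * Gamma (5/2 + 2 * u) / (Gamma (1/2 + 2 * u + 2 * y) * (Gamma (1/2 + u))\<^sup>2)"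
  have "(\<lambda>N. ?C N * of_nat N ^ 3 * (wsum (u + of_nat N) y / of_nat N ^ 3))
      \<longlonglongrightarrow> exp (2 * (y - 1) * of_real (ln 2)) * ?G * 16"
    by (intro tendsto_mult pochhammer_quotient_asymp wsum_asymp assms)
  moreover have "\<forall>\<^sub>F N in sequentially. ?C N * of_nat N ^ 3 * (wsum (u + of_nat N) y / of_nat N ^ 3) = wsum u y"
  proof (rule eventually_mono[OF eventually_gt_at_top[of 0]])
    fix N :: nat
    assume "N > 0"
    then show "?C N * of_nat N ^ 3 * (wsum (u + of_nat N) y / of_nat N ^ 3) = wsum u y"
      by (subst wsum_iterate[OF assms, of N]) simp
  qed
  ultimately have "(\<lambda>N::nat. wsum u y) \<longlonglongrightarrow> exp (2 * (y - 1) * of_real (ln 2)) * ?G * 16"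
    by (rule Lim_transform_eventually)
  then have "wsum u y = exp (2 * (y - 1) * of_real (ln 2)) * ?G * 16"
    by (rule LIMSEQ_unique[OF tendsto_const])
  moreover have "exp (2 * (y - 1) * of_real (ln 2)) = exp (2 * of_real (ln 2) * y) / 4"
  proof -
    have "exp (2 * of_real (ln 2)) = (4 :: complex)"
      unfolding exp_double exp_of_real by simp
    moreover have "2 * (y - 1) * of_real (ln 2) = 2 * of_real (ln 2) * y - 2 * of_real (ln 2)"
      by (simp add: algebra_simps)
    ultimately show ?thesis
      by (simp add: exp_diff)
  qed
  ultimately have "wsum u y = exp (2 * of_real (ln 2) * y) / 4 * ?G * 16"
    by (simp only:)
  then show ?thesis
    by (simp add: mult_ac)
qed

lemma wsum_0_0: "wsum 0 0 = of_real (3 / pi)"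
proof -
  have "Gamma (3/2 + 1 :: complex) = 3/2 * Gamma (1/2 + 1)"
    by (subst Gamma_plus1) (auto elim!: nonpos_Ints_cases' simp: complex_eq_iff)
  also have "Gamma (1/2 + 1 :: complex) = 1/2 * Gamma (1/2)"
    by (subst Gamma_plus1) (auto elim!: nonpos_Ints_cases' simp: complex_eq_iff)
  finally have G: "Gamma (5/2 :: complex) = 3/4 * Gamma (1/2)"
    by simp
  have "complex_of_real (sqrt pi) * complex_of_real (sqrt pi) = of_real pi"
    by (simp flip: of_real_mult)
  then show ?thesis
    by (subst wsum_closed) (simp_all add: G Gamma_one_half_complex power2_eq_square field_simps)
qed

section \<open>Differentiation in the parameters\<close>

text \<open>Logarithmic derivative at 0, written without division. It is additive over products,
  which suits the Pochhammer and Gamma quotients.\<close>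

definition has_log_deriv :: "(complex \<Rightarrow> complex) \<Rightarrow> complex \<Rightarrow> bool" where
  "has_log_deriv f L \<longleftrightarrow> (f has_field_derivative f 0 * L) (at 0)"

lemma has_log_deriv_const: "has_log_deriv (\<lambda>w. c) 0"
  by (simp add: has_log_deriv_def)

lemma has_log_deriv_mult:
  "has_log_deriv f L \<Longrightarrow> has_log_deriv g M \<Longrightarrow> has_log_deriv (\<lambda>w. f w * g w) (L + M)"
  unfolding has_log_deriv_def by (auto intro!: derivative_eq_intros simp: algebra_simps)

lemma has_log_deriv_divide:
  "has_log_deriv f L \<Longrightarrow> has_log_deriv g M \<Longrightarrow> g 0 \<noteq> 0 \<Longrightarrow> has_log_deriv (\<lambda>w. f w / g w) (L - M)"
  unfolding has_log_deriv_def by (auto intro!: derivative_eq_intros simp: field_simps)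

lemma has_log_deriv_power2:
  "has_log_deriv f L \<Longrightarrow> has_log_deriv (\<lambda>w. (f w)\<^sup>2) (2 * L)"
  unfolding power2_eq_square mult_2 by (rule has_log_deriv_mult)

lemma has_log_deriv_exp: "has_log_deriv (\<lambda>w. exp (c * w)) c"
  unfolding has_log_deriv_def by (auto intro!: derivative_eq_intros)

lemma has_log_deriv_pochhammer:
  assumes "0 < Re a"
  shows "has_log_deriv (\<lambda>w. pochhammer (a + b * w) n) (b * (\<Sum>j<n. 1 / (a + of_nat j)))"
proof (induction n)
  case 0
  show ?case
    by (simp add: has_log_deriv_const)
next
  case (Suc n)
  have "has_log_deriv (\<lambda>w. a + b * w + of_nat n) (b / (a + of_nat n))"
    using Re_pos_nonzero(1)[OF assms, of n] unfolding has_log_deriv_def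
    by (auto intro!: derivative_eq_intros)
  from has_log_deriv_mult[OF Suc this] show ?case
    by (simp add: pochhammer_Suc algebra_simps)
qed

lemma has_log_deriv_Gamma:
  assumes "0 < Re a"
  shows "has_log_deriv (\<lambda>w. Gamma (a + b * w)) (b * Digamma a)"
proof -
  have "a \<notin> \<int>\<^sub>\<le>\<^sub>0"
    using assms by (auto elim!: nonpos_Ints_cases')
  then show ?thesis
    unfolding has_log_deriv_def by (auto intro!: derivative_eq_intros)
qed

text \<open>Along (pw,qw), the varying Pochhammer symbols with base 1/2 move at speeds 2p+2q, p
  (squared, so twice) and -q, adding up to 4p+q.\<close>

lemma has_log_deriv_wterm:
  "has_log_deriv (\<lambda>w. wterm (p * w) (q * w) n)
    ((4 * p + q) * (\<Sum>j<n. 1 / (1/2 + of_nat j)) - 2 * (p + q) * harm n - 2 * p * (\<Sum>j<3 * n. 1 / (5/2 + of_nat j)))"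
proof -
  let ?d = "\<lambda>a n. \<Sum>j<n. 1 / (a + of_nat j) :: complex"
  have H: "?d 1 n = harm n"
    by (simp add: harm_altdef inverse_eq_divide add.commute)
  have eqs: "1/2 + 2 * (p * w) + 2 * (q * w) = 1/2 + (2 * p + 2 * q) * w"
    "1/2 - q * w = 1/2 + (- q) * w" "1 + p * w + q * w = 1 + (p + q) * w" "5/2 + 2 * (p * w) = 5/2 + (2 * p) * w" for w
    by (simp_all add: algebra_simps)
  have "has_log_deriv (\<lambda>w. wterm (p * w) (q * w) n)
    ((0 + (2 * p + 2 * q) * ?d (1/2) n + 2 * (p * ?d (1/2) n) + (- q) * ?d (1/2) n)
      - (0 + 2 * ((p + q) * ?d 1 n) + (2 * p) * ?d (5/2) (3 * n)))"
    unfolding wterm_def eqs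
    by (intro has_log_deriv_divide has_log_deriv_mult has_log_deriv_power2 has_log_deriv_pochhammer has_log_deriv_const)
      (auto simp: Re_pos_nonzero(2))
  then show ?thesis
    unfolding H by (simp add: algebra_simps)
qed

text \<open>The factor \<open>1 + 2 * of_nat n\<close> is pulled out to complete
  \<open>wterm 0 0 n\<close> to the theorem's summand. It divides the y-derivative of
  \<open>wpoly\<close> at the origin but not the x-derivative, hence the remaining fraction.\<close>

lemma deriv_wsummand:
  "((\<lambda>w. wterm (p * w) (q * w) n * wpoly (p * w) (q * w) (of_nat n)) has_field_derivative
      wterm 0 0 n * (1 + 2 * of_nat n) * ((28 * (of_nat n)\<^sup>2 + 10 * of_nat n + 1)
        * ((4 * p + q) * (\<Sum>j<n. 1 / (1/2 + of_nat j)) - 2 * (p + q) * harm n - 2 * p * (\<Sum>j<3 * n. 1 / (5/2 + of_nat j)))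
      + p * (112 * (of_nat n)\<^sup>2 + 64 * of_nat n + 8) / (1 + 2 * of_nat n) + q * (20 * of_nat n + 4))) (at 0)"
proof -
  define m :: complex where "m = of_nat n"
  define L where "L = (4 * p + q) * (\<Sum>j<n. 1 / (1/2 + of_nat j)) - 2 * (p + q) * harm n - 2 * p * (\<Sum>j<3 * n. 1 / (5/2 + of_nat j))"
  have nz: "1 + 2 * m \<noteq> 0"
    unfolding m_def by (auto simp: complex_eq_iff)
  have 1: "((\<lambda>w. wterm (p * w) (q * w) n) has_field_derivative wterm 0 0 n * L) (at 0)"
    using has_log_deriv_wterm[of p q n] by (simp add: has_log_deriv_def L_def)
  have 2: "((\<lambda>w. wpoly (p * w) (q * w) m) has_field_derivative
      p * (112 * m\<^sup>2 + 64 * m + 8) + q * ((1 + 2 * m) * (20 * m + 4))) (at 0)"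
    unfolding wpoly_def
    by (rule derivative_eq_intros refl)+ (simp add: algebra_simps power2_eq_square)
  have 3: "wpoly 0 0 m = (1 + 2 * m) * (28 * m\<^sup>2 + 10 * m + 1)"
    by (simp add: wpoly_def algebra_simps power2_eq_square)
  have "((\<lambda>w. wterm (p * w) (q * w) n * wpoly (p * w) (q * w) m) has_field_derivative
      wterm 0 0 n * L * wpoly 0 0 m
      + (p * (112 * m\<^sup>2 + 64 * m + 8) + q * ((1 + 2 * m) * (20 * m + 4))) * wterm 0 0 n) (at 0)"
    using DERIV_mult[OF 1 2] by (simp add: mult_ac)
  also have "wterm 0 0 n * L * wpoly 0 0 m
      + (p * (112 * m\<^sup>2 + 64 * m + 8) + q * ((1 + 2 * m) * (20 * m + 4))) * wterm 0 0 n
    = wterm 0 0 n * (1 + 2 * m) * ((28 * m\<^sup>2 + 10 * m + 1) * L + p * (112 * m\<^sup>2 + 64 * m + 8) / (1 + 2 * m) + q * (20 * m + 4))"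
  proof -
    have "t * L * (r * A) + (B + q * (r * C)) * t = t * r * (A * L + B / r + q * C)"
      if "r \<noteq> 0" for t A B C r :: complex
      using that by (simp add: field_simps)
    from this[OF nz] show ?thesis
      unfolding 3 .
  qed
  finally show ?thesis
    unfolding m_def L_def .
qed

section \<open>Specialisation at the origin\<close>

definition csummand :: "nat \<Rightarrow> complex" where
  "csummand k = of_nat ((2 * k) choose k) ^ 5
    / ((6 * of_nat k + 1) * (- 64) ^ k * of_nat ((3 * k) choose k) * of_nat ((6 * k) choose (3 * k)))"

text \<open>The duplication formula turns (2k)! and (6k)! into (1/2)_k and (1/2)_{3k}. Moreover
  (5/2)_{3k} = (1/2)_{3k} (6k+1)(1+2k), whose last factor cancels.\<close>

lemma wterm_0_0: "wterm 0 0 k * (1 + 2 * of_nat k) = csummand k"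
proof -
  define P :: complex where "P = pochhammer (1/2) k"
  define Q :: complex where "Q = pochhammer (1/2) (3 * k)"
  have nz: "P \<noteq> 0" "Q \<noteq> 0"
    by (auto simp: P_def Q_def Re_pos_nonzero(2))
  have nz': "1 + 2 * of_nat k \<noteq> (0 :: complex)" "6 * of_nat k + 1 \<noteq> (0 :: complex)"
    by (auto simp: complex_eq_iff)
  have "pochhammer (5/2 :: complex) (3 * k) = 4/3 * pochhammer (1/2) (Suc (Suc (3 * k)))"
    by (simp add: pochhammer_rec)
  then have five: "pochhammer (5/2 :: complex) (3 * k) = Q * ((6 * of_nat k + 1) * (1 + 2 * of_nat k))"
    unfolding pochhammer_Suc Q_def by (simp add: algebra_simps)
  have f2: "fact (2 * k) = 4 ^ k * P * fact k"
    by (simp add: fact_double P_def power_mult)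
  have f6: "fact (6 * k) = 64 ^ k * Q * fact (3 * k)"
    using fact_double[of "3 * k", where ?'a = complex] by (simp add: Q_def power_mult)
  have b2: "of_nat ((2 * k) choose k) = (fact (2 * k) / (fact k * fact k) :: complex)"
    using binomial_fact[of k "2 * k"] by simp
  have b3: "of_nat ((3 * k) choose k) = (fact (3 * k) / (fact k * fact (2 * k)) :: complex)"
    using binomial_fact[of k "3 * k"] by simp
  have b6: "of_nat ((6 * k) choose (3 * k)) = (fact (6 * k) / (fact (3 * k) * fact (3 * k)) :: complex)"
    using binomial_fact[of "3 * k" "6 * k"] by simp
  have neg: "(- 64) ^ k = (- 1) ^ k * (64 :: complex) ^ k"
    by (simp flip: power_mult_distrib)
  have four: "(64 :: complex) ^ k = 4 ^ k * 4 ^ k * 4 ^ k"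
    by (simp flip: power_mult_distrib)
  have "wterm 0 0 k * (1 + 2 * of_nat k) = (- 1) ^ k * P ^ 6 / (fact k ^ 3 * Q * (6 * of_nat k + 1))"
    unfolding wterm_def using nz nz' five
    by (simp add: P_def pochhammer_fact[symmetric] power2_eq_square power3_eq_cube eval_nat_numeral)
  also have "\<dots> = P ^ 6 / ((- 1) ^ k * fact k ^ 3 * Q * (6 * of_nat k + 1))"
    by (cases "even k") simp_all
  also have "\<dots> = csummand k"
  proof -
    \<comment> \<open>Here s, g, K, F, r stand for (-1)^k, 4^k, k!, (3k)! and 6k+1, leaving a purely
      rational identity.\<close>
    have gen: "P ^ 6 / (s * K ^ 3 * Q * r) = (g * P * K / (K * K)) ^ 5
        / (r * (s * (g * g * g)) * (F / (K * (g * P * K))) * (g * g * g * Q * F / (F * F)))"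
      if "s \<noteq> 0" "g \<noteq> 0" "K \<noteq> 0" "F \<noteq> 0" "r \<noteq> 0" for s g K F r :: complex
      using that nz by (simp add: field_simps eval_nat_numeral)
    show ?thesis
      unfolding csummand_def b2 b3 b6 f2 f6 neg four by (rule gen) (use nz'(2) in simp_all)
  qed
  finally show ?thesis .
qed

text \<open>The derivative at 0 of w -> S(pw,qw) is computed twice: term by term, and from the Gamma
  closed form, whose value at 0 is 3/pi.\<close>

lemma wsum_direction_deriv:
  fixes p q :: complex
  shows "(\<lambda>k. csummand k * ((28 * (of_nat k)\<^sup>2 + 10 * of_nat k + 1)
        * ((4 * p + q) * (\<Sum>j<k. 1 / (1/2 + of_nat j)) - 2 * (p + q) * harm k - 2 * p * (\<Sum>j<3 * k. 1 / (5/2 + of_nat j)))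
      + p * (112 * (of_nat k)\<^sup>2 + 64 * of_nat k + 8) / (1 + 2 * of_nat k) + q * (20 * of_nat k + 4)))
    sums (of_real (3 / pi) * (2 * of_real (ln 2) * q + 2 * (p + q) * Digamma 1 + 2 * p * Digamma (5/2)
      - (4 * p + 2 * q) * Digamma (1/2)))"
proof -
  \<comment> \<open>Chosen so that \<open>p * w\<close> and \<open>q * w\<close> stay within 1/16;
    the summand 1 keeps the denominator positive when p = q = 0.\<close>
  define r where "r = 1 / (16 * (1 + norm p + norm q))"
  define S where "S = ball (0 :: complex) r"
  define f where "f = (\<lambda>n w. wterm (p * w) (q * w) n * wpoly (p * w) (q * w) (of_nat n))"
  define F where "F = (\<lambda>w. 4 * exp (2 * of_real (ln 2) * (q * w)) * (Gamma (1 + p * w + q * w))\<^sup>2 * Gamma (5/2 + 2 * (p * w))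
      / (Gamma (1/2 + 2 * (p * w) + 2 * (q * w)) * (Gamma (1/2 + p * w))\<^sup>2))"
  have D: "1 + norm p + norm q > 0"
    by (smt (verit) norm_ge_zero)
  then have r: "r > 0"
    by (simp add: r_def)
  have S: "open S" "0 \<in> S"
    using r by (auto simp: S_def)
  have small: "norm (p * w) \<le> 1/16 \<and> norm (q * w) \<le> 1/16" if "w \<in> S" for w
  proof -
    have "(1 + norm p + norm q) * norm w \<le> (1 + norm p + norm q) * r"
      using that D by (intro mult_left_mono) (auto simp: S_def)
    also have "\<dots> = 1/16"
      using D by (simp add: r_def)
    finally have "norm w + norm p * norm w + norm q * norm w \<le> 1/16"
      by (simp add: algebra_simps)
    then show ?thesis
      unfolding norm_mult using norm_ge_zero[of w] mult_nonneg_nonneg[OF norm_ge_zero norm_ge_zero, of p w]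
        mult_nonneg_nonneg[OF norm_ge_zero norm_ge_zero, of q w] by linarith
  qed
  have sums: "(\<lambda>n. f n w) sums F w" if "w \<in> S" for w
    using wsum_sums[of "p * w" "q * w" "p * w" 0] wsum_closed[of "p * w" "q * w"] small[OF that]
    by (simp add: f_def F_def)
  have hol: "f n holomorphic_on S" for n
  proof -
    have nz: "pochhammer (1 + p * w + q * w) n \<noteq> 0" "pochhammer (5/2 + 2 * (p * w)) (3 * n) \<noteq> 0" if "w \<in> S" for w
    proof -
      have "Re (p * w) \<ge> - 1/16" "Re (q * w) \<ge> - 1/16"
        using small[OF that] abs_Re_le_cmod[of "p * w"] abs_Re_le_cmod[of "q * w"] by linarith+
      then show "pochhammer (1 + p * w + q * w) n \<noteq> 0" "pochhammer (5/2 + 2 * (p * w)) (3 * n) \<noteq> 0"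
        by (intro Re_pos_nonzero(2); simp)+
    qed
    have poch: "(\<lambda>w. pochhammer (g w) k) holomorphic_on S" if "g holomorphic_on S" for g k
      unfolding pochhammer_prod by (intro holomorphic_intros that)
    show ?thesis
      unfolding f_def wterm_def wpoly_def
      by (intro holomorphic_intros poch) (use nz in auto)
  qed
  have deriv: "(f n has_field_derivative deriv (f n) w) (at w)" if "w \<in> S" for n w
    using holomorphic_derivI[OF hol S(1) that] .
  \<comment> \<open>One geometric majorant, the case \<open>N = 0\<close> of
    \<open>norm_wsummand_le\<close>, works on all of \<open>S\<close>, so the radius 1 is
    arbitrary.\<close>
  have bound: "\<exists>d h. 0 < d \<and> summable h \<and> range h \<subseteq> \<real>\<^sub>\<ge>\<^sub>0
      \<and> (\<forall>\<^sub>F n in sequentially. \<forall>y\<in>ball w d \<inter> S. cmod (f n y) \<le> cmod (h n))" if "w \<in> S" for w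
  proof (intro exI conjI)
    let ?h = "\<lambda>n. of_real (68 * (8/9) ^ n) :: complex"
    show "0 < (1 :: real)"
      by simp
    show "summable ?h"
      by (intro summable_of_real summable_mult summable_geometric) simp
    show "range ?h \<subseteq> \<real>\<^sub>\<ge>\<^sub>0"
      by (auto simp: complex_nonneg_Reals_iff)
    show "\<forall>\<^sub>F n in sequentially. \<forall>y\<in>ball w 1 \<inter> S. cmod (f n y) \<le> cmod (?h n)"
    proof (intro always_eventually allI ballI)
      fix n y
      assume "y \<in> ball w 1 \<inter> S"
      then show "cmod (f n y) \<le> cmod (?h n)"
        using norm_wsummand_le(1)[of "p * y" "q * y" "p * y" 0 n] small[of y]
        unfolding norm_of_real by (simp add: f_def)
    qed
  qed
  obtain g g' where g: "\<And>w. w \<in> S \<Longrightarrow> (\<lambda>n. f n w) sums g w \<and> (\<lambda>n. deriv (f n) w) sums g' w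
      \<and> (g has_field_derivative g' w) (at w)"
    using series_and_derivative_comparison_complex[OF S(1), of f "\<lambda>n. deriv (f n)"] deriv bound by blast
  \<comment> \<open>\<open>g\<close> and \<open>F\<close> are sums of the same series on
    \<open>S\<close>; hence the termwise derivative sum \<open>g' 0\<close> is the derivative of
    \<open>F\<close>.\<close>
  have "(F has_field_derivative g' 0) (at 0)"
  proof (rule has_field_derivative_transform_within_open[OF _ S])
    show "(g has_field_derivative g' 0) (at 0)"
      using g[OF S(2)] by blast
    show "g w = F w" if "w \<in> S" for w
      using g[OF that] sums[OF that] sums_unique2 by blast
  qed
  moreover have "(F has_field_derivative of_real (3 / pi) * (2 * of_real (ln 2) * q + 2 * (p + q) * Digamma 1
      + 2 * p * Digamma (5/2) - (4 * p + 2 * q) * Digamma (1/2))) (at 0)"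
  proof -
    have eqs: "1/2 + 2 * (p * w) + 2 * (q * w) = 1/2 + (2 * p + 2 * q) * w" "2 * of_real (ln 2) * (q * w) = (2 * of_real (ln 2) * q) * w"
      "1 + p * w + q * w = 1 + (p + q) * w" "5/2 + 2 * (p * w) = 5/2 + (2 * p) * w" for w
      by (simp_all add: algebra_simps)
    have "has_log_deriv F ((0 + 2 * of_real (ln 2) * q + 2 * ((p + q) * Digamma 1) + 2 * p * Digamma (5/2))
        - ((2 * p + 2 * q) * Digamma (1/2) + 2 * (p * Digamma (1/2))))"
      unfolding F_def eqs
      by (intro has_log_deriv_divide has_log_deriv_mult has_log_deriv_power2 has_log_deriv_Gamma
          has_log_deriv_const has_log_deriv_exp) (auto simp: Gamma_Re_pos_nonzero)
    moreover have "F 0 = of_real (3 / pi)"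
      using wsum_closed[of 0 0] wsum_0_0 by (simp add: F_def)
    ultimately show ?thesis
      unfolding has_log_deriv_def by (simp add: algebra_simps)
  qed
  ultimately have g': "g' 0 = of_real (3 / pi) * (2 * of_real (ln 2) * q + 2 * (p + q) * Digamma 1
      + 2 * p * Digamma (5/2) - (4 * p + 2 * q) * Digamma (1/2))"
    by (rule DERIV_unique)
  have "(\<lambda>n. deriv (f n) 0) sums g' 0"
    using g[OF S(2)] by blast
  then show ?thesis
    unfolding g' f_def DERIV_imp_deriv[OF deriv_wsummand] wterm_0_0 .
qed

text \<open>The terms are twice the reciprocals of the odd numbers below 2n, that is, twice
  \<open>harm (2 * n)\<close> with its even part removed.\<close>

lemma sum_inverse_half:
  "(\<Sum>j<n. 1 / (1/2 + of_nat j)) = 2 * harm (2 * n) - (harm n :: 'a :: real_normed_field)"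
proof (induction n)
  case (Suc n)
  have *: "of_nat (Suc (2 * n)) = 2 * (1/2 + of_nat n :: 'a)" "of_nat (Suc (Suc (2 * n))) = 2 * (of_nat (Suc n) :: 'a)"
    by (simp_all add: algebra_simps)
  have step: "1 / (1/2 + of_nat n) = 2 * (inverse (of_nat (Suc (2 * n))) + inverse (of_nat (Suc (Suc (2 * n)))))
      - inverse (of_nat (Suc n) :: 'a)"
    unfolding *
  proof -
    show "1 / x = 2 * (inverse (2 * x) + inverse (2 * y)) - inverse y" for x y :: 'a
      by (simp add: inverse_eq_divide distrib_left)
  qed
  have double: "harm (2 * Suc n) = harm (2 * n) + inverse (of_nat (Suc (2 * n))) + inverse (of_nat (Suc (Suc (2 * n))) :: 'a)"
    by (simp add: harm_Suc)
  show ?case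
    unfolding sum.lessThan_Suc Suc.IH step double harm_Suc[of n] by (simp add: algebra_simps)
qed (simp add: harm_def)

text \<open>The base-1/2 sum of length n + 2 starts with 2 + 2/3 = 8/3 and ends with the two
  fractions shown.\<close>

lemma sum_inverse_five_half:
  "(\<Sum>j<n. 1 / (5/2 + of_nat j))
    = 2 * harm (2 * n) - harm n + 2 / (2 * of_nat n + 1) + 2 / (2 * of_nat n + 3) - (8/3 :: complex)"
proof -
  have "(\<Sum>j<Suc (Suc n). 1 / (1/2 + of_nat j :: complex)) = 2 + 2/3 + (\<Sum>j<n. 1 / (5/2 + of_nat j))"
    unfolding sum.lessThan_Suc_shift by (simp add: add_ac)
  moreover have "(\<Sum>j<Suc (Suc n). 1 / (1/2 + of_nat j :: complex))
      = (\<Sum>j<n. 1 / (1/2 + of_nat j)) + 2 / (2 * of_nat n + 1) + 2 / (2 * of_nat n + 3)"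
  proof -
    have "2 * of_nat n + 1 \<noteq> (0 :: complex)" "2 * of_nat n + 3 \<noteq> (0 :: complex)"
      by (auto simp: complex_eq_iff)
    then show ?thesis
      by (simp add: field_simps)
  qed
  ultimately show ?thesis
    unfolding sum_inverse_half by (simp add: algebra_simps)
qed

section \<open>The real series\<close>

definition rsummand :: "nat \<Rightarrow> real" where
  "rsummand k = (real ((2 * k) choose k)) ^ 5
    / ((6 * real k + 1) * (- 64) ^ k * real ((3 * k) choose k) * real ((6 * k) choose (3 * k)))"

lemma csummand_eq: "csummand k = of_real (rsummand k)"
  by (simp add: csummand_def rsummand_def)

lemma rsummand_sums: "(\<lambda>k. rsummand k * (28 * (real k)\<^sup>2 + 10 * real k + 1)) sums (3 / pi)"
proof -
  have "wterm 0 0 k * wpoly 0 0 (of_nat k) = of_real (rsummand k * (28 * (real k)\<^sup>2 + 10 * real k + 1))" for k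
  proof -
    have "wpoly 0 0 (of_nat k) = (1 + 2 * of_nat k) * (28 * (of_nat k)\<^sup>2 + 10 * of_nat k + 1)"
      by (simp add: wpoly_def algebra_simps power2_eq_square)
    then have "wterm 0 0 k * wpoly 0 0 (of_nat k) = csummand k * (28 * (of_nat k)\<^sup>2 + 10 * of_nat k + 1)"
      by (simp flip: wterm_0_0)
    then show ?thesis
      by (simp add: csummand_eq)
  qed
  then show ?thesis
    using wsum_sums[of 0 0 0 0] unfolding wsum_0_0 by (simp only: sums_of_real_iff) simp
qed

text \<open>Digamma at 1, 1/2 and 5/2 equals -gamma, -gamma - 2 ln 2 and -gamma - 2 ln 2 + 8/3.
  Euler's constant enters with coefficient 2(p+q) + 2p - (4p+2q) = 0.\<close>

lemma rsummand_direction_sums: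
  fixes p q :: real
  shows "(\<lambda>k. rsummand k * ((28 * (real k)\<^sup>2 + 10 * real k + 1)
        * ((4 * p + q) * (2 * harm (2 * k) - harm k) - 2 * (p + q) * harm k
          - 2 * p * (2 * harm (6 * k) - harm (3 * k) + 2 / (6 * real k + 1) + 2 / (6 * real k + 3) - 8/3))
      + p * (112 * (real k)\<^sup>2 + 64 * real k + 8) / (1 + 2 * real k) + q * (20 * real k + 4)))
    sums (3 / pi * ((4 * p + 6 * q) * ln 2 + 16/3 * p))"
    (is "?f sums ?s")
proof -
  have "Digamma (3/2 + 1 :: complex) = Digamma (1/2 + 1) + 2/3"
    by (subst Digamma_plus1) (auto simp: complex_eq_iff)
  also have "Digamma (1/2 + 1 :: complex) = Digamma (1/2) + 2"
    by (subst Digamma_plus1) (auto simp: complex_eq_iff)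
  finally have D: "Digamma (5/2 :: complex) = - of_real euler_mascheroni - of_real (2 * ln 2) + 8/3"
    by (simp add: Digamma_one_half)
  have "2 * of_real (ln 2) * of_real q + 2 * (of_real p + of_real q) * Digamma 1 + 2 * of_real p * Digamma (5/2)
      - (4 * of_real p + 2 * of_real q) * Digamma (1/2)
    = complex_of_real ((4 * p + 6 * q) * ln 2 + 16/3 * p)"
    unfolding D Digamma_one_half by (simp add: algebra_simps)
  then have "(\<lambda>k. of_real (?f k)) sums complex_of_real ?s"
    using wsum_direction_deriv[of "of_real p" "of_real q"]
    by (simp add: csummand_eq sum_inverse_half sum_inverse_five_half of_real_harm)
  then show ?thesis
    by (simp only: sums_of_real_iff)
qed

theorem theorem1p2:
  fixes f :: "nat \<Rightarrow> real"
  assumes f: "\<And>k. f k = 4 * (138 * (real k)^2 + 52 * real k + 5) / (3 * (6 * real k + 1))"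
  shows
    "((\<lambda>k. (28 * (real k)^2 + 10 * real k + 1) * (real ((2*k) choose k))^5
          / ((6 * real k + 1) * (-64)^k * real ((3*k) choose k) * real ((6*k) choose (3*k))))
       sums (3 / pi)) \<and>
     ((\<lambda>k. ((28 * (real k)^2 + 10 * real k + 1) * (2 * harm (2*k) - 3 * harm k) + 20 * real k + 4)
            * (real ((2*k) choose k))^5
          / ((6 * real k + 1) * (-64)^k * real ((3*k) choose k) * real ((6*k) choose (3*k))))
       sums (18 * ln 2 / pi)) \<and>
     ((\<lambda>k. ((28 * (real k)^2 + 10 * real k + 1) * (2 * harm (6*k) - harm (3*k) - 3 * harm k) + f k)
            * (real ((2*k) choose k))^5
          / ((6 * real k + 1) * (-64)^k * real ((3*k) choose k) * real ((6*k) choose (3*k))))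
       sums (30 * ln 2 / pi))"
proof -
  have r: "x * (real ((2*k) choose k))^5
      / ((6 * real k + 1) * (-64)^k * real ((3*k) choose k) * real ((6*k) choose (3*k))) = rsummand k * x" for x k
    by (simp add: rsummand_def)
  have 2: "(\<lambda>k. rsummand k * ((28 * (real k)\<^sup>2 + 10 * real k + 1) * (2 * harm (2*k) - 3 * harm k) + 20 * real k + 4))
      sums (18 * ln 2 / pi)"
    using rsummand_direction_sums[of 0 1] by (simp add: algebra_simps)
  \<comment> \<open>For p = -1/2, q = 2 the coefficient 4p + q vanishes, removing
    \<open>harm (2 * k)\<close>, while -2(p+q) = -3 and -2p = 1. Adding 8/3 of the first series
    cancels the constant -8/3.\<close>
  have 3: "rsummand k * ((28 * (real k)\<^sup>2 + 10 * real k + 1)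
        * ((4 * (- 1/2) + 2) * (2 * harm (2 * k) - harm k) - 2 * (- 1/2 + 2) * harm k
          - 2 * (- 1/2) * (2 * harm (6 * k) - harm (3 * k) + 2 / (6 * real k + 1) + 2 / (6 * real k + 3) - 8/3))
      + (- 1/2) * (112 * (real k)\<^sup>2 + 64 * real k + 8) / (1 + 2 * real k) + 2 * (20 * real k + 4))
      + 8/3 * (rsummand k * (28 * (real k)\<^sup>2 + 10 * real k + 1))
    = rsummand k * ((28 * (real k)^2 + 10 * real k + 1) * (2 * harm (6*k) - harm (3*k) - 3 * harm k) + f k)" for k
  proof -
    define A where "A = 28 * (real k)\<^sup>2 + 10 * real k + 1"
    \<comment> \<open>The parts with denominator 1 + 2k combine to the polynomial -(56k + 10)/3, so
      only the denominator of \<open>f\<close> survives.\<close>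
    have "A * (2 / (6 * real k + 1)) + A * (2 / (6 * real k + 3))
        - (56 * (real k)\<^sup>2 + 32 * real k + 4) / (1 + 2 * real k) + 40 * real k + 8 = f k"
    proof -
      have "6 * real k + 3 = 3 * (1 + 2 * real k)" "1 + 2 * real k \<noteq> 0" "6 * real k + 1 \<noteq> 0"
        by auto
      then show ?thesis
        unfolding f A_def by (simp add: divide_simps) (simp add: algebra_simps power2_eq_square)
    qed
    moreover have "(- 1/2) * (112 * (real k)\<^sup>2 + 64 * real k + 8) / (1 + 2 * real k)
        = - ((56 * (real k)\<^sup>2 + 32 * real k + 4) / (1 + 2 * real k))"
    proof -
      have "(- 1/2) * (112 * (real k)\<^sup>2 + 64 * real k + 8) = - (56 * (real k)\<^sup>2 + 32 * real k + 4)"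
        by (simp add: field_simps)
      then show ?thesis
        by (simp only: minus_divide_left)
    qed
    ultimately show ?thesis
      unfolding A_def[symmetric] by (simp add: algebra_simps)
  qed
  \<comment> \<open>The rational contributions -8/pi and 8/pi cancel, leaving 10 ln 2 times
    3/pi.\<close>
  have "3 / pi * ((4 * (- 1/2) + 6 * 2) * ln 2 + 16/3 * (- 1/2)) + 8/3 * (3 / pi) = 30 * ln 2 / pi"
    by (simp add: field_simps)
  then show ?thesis
    using rsummand_sums 2 sums_add[OF rsummand_direction_sums[of "- 1/2" 2] sums_mult[OF rsummand_sums, of "8/3"]]
    unfolding r 3 by simp
qed

end
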